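(* Let $G$ and $G^{*}$ be groups, let $P = (\sigma_P, \tau_P, \eta_P)$ be a picture fuzzy normal subgroup of $G$ and let $Q = (\sigma_Q, \tau_Q, \eta_Q)$ be a picture fuzzy normal subgroup of $G^{*}$. Then $P \times Q$ is a picture fuzzy normal subgroup of the group $G \times G^{*}$.
   Context: A picture fuzzy set (PFS) $Q = (\sigma_Q, \tau_Q, \eta_Q)$ of a set $Y$ consists of three functions $\sigma_Q, \tau_Q, \eta_Q : Y \to [0,1]$ with $0 \le \sigma_Q(y) + \tau_Q(y) + \eta_Q(y) \le 1$ for all $y \in Y$. A PFS $Q$ of a group $G$ is a picture fuzzy subgroup (PFSG) of $G$ if for all $a,b \in G$: (i) $\sigma_Q(ab) \ge \min\{\sigma_Q(a), \sigma_Q(b)\}$, $\tau_Q(ab) \ge \min\{\tau_Q(a), \tau_Q(b)\}$, $\eta_Q(ab) \le \max\{\eta_Q(a), \eta_Q(b)\}$; and (ii) $\sigma_Q(a^{-1}) \ge \sigma_Q(a)$, $\tau_Q(a^{-1}) \ge \tau_Q(a)$, $\eta_Q(a^{-1}) \le \eta_Q(a)$. A PFSG $Q$ of $G$ is a picture fuzzy normal subgroup (PFNSG) of $G$ if $\sigma_Q(ab) = \sigma_Q(ba)$, $\tau_Q(ab) = \tau_Q(ba)$ and $\eta_Q(ab) = \eta_Q(ba)$ for all $a, b \in G$. The Cartesian (direct) product of a PFS $P$ of $Y_1$ and a PFS $Q$ of $Y_2$ is the PFS $P \times Q$ of $Y_1 \times Y_2$ given by $\sigma_{P\times Q}(p,q)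 = \min\{\sigma_P(p), \sigma_Q(q)\}$, $\tau_{P\times Q}(p,q) = \min\{\tau_P(p), \tau_Q(q)\}$, $\eta_{P\times Q}(p,q) = \max\{\eta_P(p), \eta_Q(q)\}$. The group $G \times G^{*}$ is the usual direct product of groups. *)

theory Defs
  imports "HOL-Algebra.Group" Complex_Main
begin

text \<open>The fields are the positive (\<open>\<sigma>\<close>), neutral (\<open>\<tau>\<close>) and negative (\<open>\<eta>\<close>) membership degrees.
  As usual in HOL-Algebra, the degrees are total functions on the type, and every condition
  below is relativised to the underlying set, resp. to the carrier of the group.\<close>

record 'a pfs =
  pos_mem :: "'a \<Rightarrow> real"
  neu_mem :: "'a \<Rightarrow> real"
  neg_mem :: "'a \<Rightarrow> real"

definition picture_fuzzy_set :: "'a set \<Rightarrow> 'a pfs \<Rightarrow> bool" where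
  "picture_fuzzy_set Y Q \<longleftrightarrow>
     (\<forall>y\<in>Y. pos_mem Q y \<in> {0..1} \<and> neu_mem Q y \<in> {0..1} \<and> neg_mem Q y \<in> {0..1} \<and>
            0 \<le> pos_mem Q y + neu_mem Q y + neg_mem Q y \<and>
            pos_mem Q y + neu_mem Q y + neg_mem Q y \<le> 1)"

locale picture_fuzzy_subgroup = group G for G (structure) +
  fixes Q :: "'a pfs"
  assumes pfs: "picture_fuzzy_set (carrier G) Q"
    and pos_mult: "\<lbrakk>a \<in> carrier G; b \<in> carrier G\<rbrakk> \<Longrightarrow>
           pos_mem Q (a \<otimes> b) \<ge> min (pos_mem Q a) (pos_mem Q b)"
    and neu_mult: "\<lbrakk>a \<in> carrier G; b \<in> carrier G\<rbrakk> \<Longrightarrow>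
           neu_mem Q (a \<otimes> b) \<ge> min (neu_mem Q a) (neu_mem Q b)"
    and neg_mult: "\<lbrakk>a \<in> carrier G; b \<in> carrier G\<rbrakk> \<Longrightarrow>
           neg_mem Q (a \<otimes> b) \<le> max (neg_mem Q a) (neg_mem Q b)"
    and pos_inv: "a \<in> carrier G \<Longrightarrow> pos_mem Q (inv a) \<ge> pos_mem Q a"
    and neu_inv: "a \<in> carrier G \<Longrightarrow> neu_mem Q (inv a) \<ge> neu_mem Q a"
    and neg_inv: "a \<in> carrier G \<Longrightarrow> neg_mem Q (inv a) \<le> neg_mem Q a"

locale picture_fuzzy_normal_subgroup = picture_fuzzy_subgroup +
  assumes pos_comm: "\<lbrakk>a \<in> carrier G; b \<in> carrier G\<rbrakk> \<Longrightarrow>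
           pos_mem Q (a \<otimes> b) = pos_mem Q (b \<otimes> a)"
    and neu_comm: "\<lbrakk>a \<in> carrier G; b \<in> carrier G\<rbrakk> \<Longrightarrow>
           neu_mem Q (a \<otimes> b) = neu_mem Q (b \<otimes> a)"
    and neg_comm: "\<lbrakk>a \<in> carrier G; b \<in> carrier G\<rbrakk> \<Longrightarrow>
           neg_mem Q (a \<otimes> b) = neg_mem Q (b \<otimes> a)"

definition pfs_prod :: "'a pfs \<Rightarrow> 'b pfs \<Rightarrow> ('a \<times> 'b) pfs" where
  "pfs_prod P Q =
     \<lparr>pos_mem = (\<lambda>(p, q). min (pos_mem P p) (pos_mem Q q)),
      neu_mem = (\<lambda>(p, q). min (neu_mem P p) (neu_mem Q q)),
      neg_mem = (\<lambda>(p, q). max (neg_mem P p) (neg_mem Q q))\<rparr>"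

end

theory Submission
  imports Defs
begin

text \<open>
  Each condition that concerns a single membership degree survives the passage to the product
  because the operations of \<open>G \<times>\<times> G'\<close> are componentwise, while the degrees of a pair are
  combined by the same lattice operation (minimum for the positive and neutral degrees, maximum
  for the negative one) that occurs in the closure conditions. So the conditions on the factors
  combine by monotonicity, after exchanging the order of two nested minima or maxima. The
  equalities expressing normality hold in each component and so for the combined degrees.

  The one condition that mixes the three degrees is the bound on their sum. It holds since the
  maximum of the two negative degrees is attained in one of the two factors, and there both
  minima are at most the degrees of that same factor.
\<close>

lemma picture_fuzzy_set_pfs_prod:
  assumes P: "picture_fuzzy_set Y P" and Q: "picture_fuzzy_set Z Q"
  shows "picture_fuzzy_set (Y \<times> Z) (pfs_prod P Q)"
  unfolding picture_fuzzy_set_def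
proof
  fix y assume "y \<in> Y \<times> Z"
  then obtain p q where y: "y = (p, q)" and "p \<in> Y" "q \<in> Z" by auto
  with P Q show "pos_mem (pfs_prod P Q) y \<in> {0..1} \<and> neu_mem (pfs_prod P Q) y \<in> {0..1} \<and>
      neg_mem (pfs_prod P Q) y \<in> {0..1} \<and>
      0 \<le> pos_mem (pfs_prod P Q) y + neu_mem (pfs_prod P Q) y + neg_mem (pfs_prod P Q) y \<and>
      pos_mem (pfs_prod P Q) y + neu_mem (pfs_prod P Q) y + neg_mem (pfs_prod P Q) y \<le> 1"
    by (fastforce simp: picture_fuzzy_set_def pfs_prod_def min_def max_def)
qed

text \<open>The interchange law for two nested minima (and dually maxima) that turns closure of the
  factors under multiplication into closure of the product.\<close>

lemma min_interchange_mono: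
  fixes a b c d :: "'a :: linorder"
  assumes "min a b \<le> x" and "min c d \<le> y"
  shows "min (min a c) (min b d) \<le> min x y"
  using min.mono[OF assms] by (simp add: min.assoc min.left_commute)

lemma max_interchange_mono:
  fixes a b c d :: "'a :: linorder"
  assumes "x \<le> max a b" and "y \<le> max c d"
  shows "max x y \<le> max (max a c) (max b d)"
  using max.mono[OF assms] by (simp add: max.assoc max.left_commute)

lemma picture_fuzzy_subgroup_pfs_prod:
  assumes "picture_fuzzy_subgroup G P" and "picture_fuzzy_subgroup G' Q"
  shows "picture_fuzzy_subgroup (G \<times>\<times> G') (pfs_prod P Q)"
proof -
  interpret P: picture_fuzzy_subgroup G P by fact
  interpret Q: picture_fuzzy_subgroup G' Q by fact
  interpret GG: group "G \<times>\<times> G'"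
    by (rule DirProd_group) (rule P.group_axioms Q.group_axioms)+
  note inv_pair = inv_DirProd[OF P.group_axioms Q.group_axioms]
  \<comment> \<open>The rules \<open>bounded_iff\<close> would split the inequalities between minima (or maxima) before the
    monotonicity rules can match them, so they are removed from the simplifier.\<close>
  show ?thesis
  proof (unfold_locales, goal_cases)
    case 1
    show ?case using picture_fuzzy_set_pfs_prod[OF P.pfs Q.pfs] by simp
  next
    case (2 a b)
    then show ?case
      by (auto simp: pfs_prod_def simp del: min.bounded_iff
          intro!: min_interchange_mono P.pos_mult Q.pos_mult)
  next
    case (3 a b)
    then show ?case
      by (auto simp: pfs_prod_def simp del: min.bounded_iff
          intro!: min_interchange_mono P.neu_mult Q.neu_mult)
  next
    case (4 a b)
    then show ?case
      by (auto simp: pfs_prod_def simp del: max.bounded_iff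
          intro!: max_interchange_mono P.neg_mult Q.neg_mult)
  next
    case (5 a)
    then show ?case
      by (auto simp: pfs_prod_def inv_pair simp del: min.bounded_iff
          intro!: min.mono P.pos_inv Q.pos_inv)
  next
    case (6 a)
    then show ?case
      by (auto simp: pfs_prod_def inv_pair simp del: min.bounded_iff
          intro!: min.mono P.neu_inv Q.neu_inv)
  next
    case (7 a)
    then show ?case
      by (auto simp: pfs_prod_def inv_pair simp del: max.bounded_iff
          intro!: max.mono P.neg_inv Q.neg_inv)
  qed
qed

theorem theorem3p3:
  fixes G :: "('a, 'm) monoid_scheme" and G' :: "('b, 'n) monoid_scheme"
    and P :: "'a pfs" and Q :: "'b pfs"
  assumes "group G" and "group G'"
    and "picture_fuzzy_normal_subgroup G P"
    and "picture_fuzzy_normal_subgroup G' Q"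
  shows "picture_fuzzy_normal_subgroup (G \<times>\<times> G') (pfs_prod P Q)"
proof -
  interpret P: picture_fuzzy_normal_subgroup G P by fact
  interpret Q: picture_fuzzy_normal_subgroup G' Q by fact
  interpret PQ: picture_fuzzy_subgroup "G \<times>\<times> G'" "pfs_prod P Q"
    by (rule picture_fuzzy_subgroup_pfs_prod)
      (rule P.picture_fuzzy_subgroup_axioms Q.picture_fuzzy_subgroup_axioms)+
  show ?thesis
    by unfold_locales
      (auto simp: pfs_prod_def
        intro!: arg_cong2[where f = min] arg_cong2[where f = max]
          P.pos_comm Q.pos_comm P.neu_comm Q.neu_comm P.neg_comm Q.neg_comm)
qed

end
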